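(* Let $n\ge 1$ be an integer, let $I\subset[0,\infty)$ be an interval, and let $f:I\to\mathbb{R}$ be an $n$-times differentiable function on $I^\circ$ such that $f^{(n)}\in L^1[a,b]$, where $a,b\in I$, $a<b$. Let $q\ge 1$ and $\frac1p=1-\frac1q$. If $|f^{(n)}|^q$ is $s$-convex (in the second sense) on $[a,b]$ for some fixed $s\in(0,1]$, then for every $\lambda\in[a,b]$, $$\left|(-1)^n\int_a^b f(x)\,dx+\sum_{m=1}^n(-1)^{n-m+2}\left[\frac{(\lambda-a)^m-(\lambda-b)^m}{m!}\right]f^{(m-1)}(\lambda)\right|$$ $$\le\frac{(n+1)^{-\frac1p}}{n!}\Big[(\lambda-a)^{n+1}\left\{\beta(s+1,n+1)|f^{(n)}(a)|^q+\beta(1,n+s+1)|f^{(n)}(\lambda)|^q\right\}^{\frac1q}$$ $$\qquad+(b-\lambda)^{n+1}\left\{\beta(s+1,n+1)|f^{(n)}(b)|^q+\beta(1,n+s+1)|f^{(n)}(\lambda)|^q\right\}^{\frac1q}\Big].$$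
   Context: $I^\circ$ denotes the interior of $I$. A real function $g$ on $[a,b]\subset[0,\infty)$ is $s$-convex (in the second sense), $s\in(0,1]$, if $g(tx+(1-t)y)\le t^s g(x)+(1-t)^s g(y)$ for all $x,y\in[a,b]$ and $t\in[0,1]$. The Beta function is $\beta(x,y)=\int_0^1 t^{x-1}(1-t)^{y-1}\,dt$ for $x,y>0$. It is understood that $f$ is $n$ times differentiable at every point of $[a,b]$ (one-sided at a point that is an endpoint of $I$), so that $f^{(n)}$ is defined on all of $[a,b]$; $f^{(0)}=f$. When $q=1$ one has $1/p=0$. *)

theory Defs
  imports "HOL-Analysis.Analysis"
begin

text \<open>At interior points of an interval \<open>I\<close> the derivative within \<open>I\<close> is the ordinary two-sided
  derivative, at an endpoint belonging to \<open>I\<close> it is one-sided. \<open>higher_deriv_within\<close> is meaningful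
  only at points where the function is sufficiently often differentiable within \<open>I\<close>.\<close>

primrec higher_deriv_within :: "real set \<Rightarrow> nat \<Rightarrow> (real \<Rightarrow> real) \<Rightarrow> real \<Rightarrow> real" where
  "higher_deriv_within I 0 f = f"
| "higher_deriv_within I (Suc k) f =
     (\<lambda>x. vector_derivative (higher_deriv_within I k f) (at x within I))"

definition n_times_differentiable_within ::
    "nat \<Rightarrow> (real \<Rightarrow> real) \<Rightarrow> real set \<Rightarrow> real set \<Rightarrow> bool" where
  "n_times_differentiable_within n f T I \<longleftrightarrow>
     (\<forall>k<n. \<forall>x\<in>T. higher_deriv_within I k f differentiable (at x within I))"

definition s_convex_on :: "real \<Rightarrow> real set \<Rightarrow> (real \<Rightarrow> real) \<Rightarrow> bool" where
  "s_convex_on s S g \<longleftrightarrow>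
     (\<forall>x\<in>S. \<forall>y\<in>S. \<forall>t\<in>{0..1}.
        g (t * x + (1 - t) * y) \<le> t powr s * g x + (1 - t) powr s * g y)"

text \<open>The library defines \<^const>\<open>Beta\<close> through the Gamma function; for positive real arguments this
  is Euler's integral.\<close>

lemma Beta_eq_integral:
  fixes x y :: real
  assumes "x > 0" "y > 0"
  shows "Beta x y = integral {0..1} (\<lambda>t. t powr (x - 1) * (1 - t) powr (y - 1))"
  using has_integral_Beta_real[OF assms] by (simp add: integral_unique)

end

theory Submission
  imports Defs
begin

text \<open>
  Let \<open>F x = integral {a..x} f\<close>. Then \<open>F\<close> has \<open>n + 1\<close> derivatives on \<open>{a..b}\<close>, and the derivative of
  order \<open>m \<ge> 1\<close> is that of \<open>f\<close> of order \<open>m - 1\<close>. Expand \<open>F b\<close> and \<open>F a\<close> by Taylor's formula around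
  \<open>lam\<close> up to order \<open>n\<close> and subtract: the terms of order zero cancel, \<open>F b - F a\<close> is the integral of
  \<open>f\<close>, and the other terms are, up to the factor \<open>-(-1) ^ n\<close>, the sum in the theorem. So the
  quantity to be estimated is the absolute value of the difference of two Taylor remainders, and the
  two summands of the bound come from the end points \<open>a\<close> and \<open>b\<close> separately.

  Substituting \<open>x = t * e + (1 - t) * lam\<close> brings the remainder at the end point \<open>e\<close> to the form
  \<open>(e - lam) ^ (n + 1) / fact n\<close> times the integral over \<open>{0..1}\<close> of the \<open>n\<close>-th derivative of \<open>f\<close>
  along the segment, with weight \<open>(1 - t) ^ n\<close> (\<open>Taylor_has_integral_along_segment\<close>).
  The power mean inequality for this weight, whose total mass is \<open>1 / (n + 1)\<close>, replaces the
  derivative by its \<open>q\<close>-th power and produces the factor \<open>(n + 1) powr (- (1 / p))\<close>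
  (\<open>powr_power_mean_le\<close>). Finally \<open>s\<close>-convexity bounds that \<open>q\<close>-th power by
  \<open>t powr s\<close> and \<open>(1 - t) powr s\<close> times its values at \<open>e\<close> and \<open>lam\<close>; integrating these two terms
  against the weight yields the two Beta values (\<open>has_integral_Beta_s_convex_majorant\<close>).
\<close>

section \<open>A weighted power mean inequality\<close>

text \<open>
  For every \<open>c > 0\<close>, Young's inequality gives \<open>\<bar>g\<bar> * c powr (1 - 1 / q) \<le> h / q + (1 - 1 / q) * c\<close>
  pointwise. Integrating this against \<open>w\<close> and choosing for \<open>c\<close> the mean \<open>H / W\<close> of \<open>h\<close> gives the
  claim. The argument is linear in \<open>g\<close> and \<open>h\<close>, so it works with the Henstock--Kurzweil integral of
  \<open>w * g\<close> that Taylor's formula supplies, and it treats \<open>q = 1\<close> together with \<open>q > 1\<close>.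
\<close>

lemma powr_power_mean_le:
  fixes w g h :: "real \<Rightarrow> real"
  assumes w: "(w has_integral W) S" and "W > 0"
    and wg: "((\<lambda>t. w t * g t) has_integral J) S"
    and wh: "((\<lambda>t. w t * h t) has_integral H) S"
    and w_nonneg: "\<And>t. t \<in> S \<Longrightarrow> 0 \<le> w t"
    and gh: "\<And>t. t \<in> S \<Longrightarrow> \<bar>g t\<bar> powr q \<le> h t"
    and "q \<ge> 1"
  shows "\<bar>J\<bar> \<le> W powr (1 - 1 / q) * H powr (1 / q)"
proof -
  have "0 \<le> h t" if "t \<in> S" for t
    using gh[OF that] by (rule order_trans[OF powr_ge_zero])
  then have "H \<ge> 0"
    by (intro has_integral_nonneg[OF wh]) (simp add: w_nonneg)
  \<comment> \<open>The mean \<open>H / W\<close> may vanish, whereas Young's inequality is applied with \<open>c > 0\<close>: hence \<open>H\<close> is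
    enlarged by \<open>d\<close>, which tends to zero at the end.\<close>
  have bound: "\<bar>J\<bar> \<le> W powr (1 - 1 / q) * (H + d) powr (1 / q)" if "d > 0" for d
  proof -
    define c where "c = (H + d) / W"
    have "c > 0" and cW: "c * W = H + d"
      using \<open>H \<ge> 0\<close> \<open>W > 0\<close> that by (simp_all add: c_def)
    have Young: "\<bar>g t\<bar> * c powr (1 - 1 / q) \<le> h t / q + (1 - 1 / q) * c" if "t \<in> S" for t
    proof (cases "g t = 0")
      case True
      then show ?thesis
        using gh[OF that] \<open>c > 0\<close> \<open>q \<ge> 1\<close> by simp
    next
      case False
      have "\<bar>g t\<bar> * c powr (1 - 1 / q) = (\<bar>g t\<bar> powr q) powr (1 / q) * c powr (1 - 1 / q)"
        using \<open>q \<ge> 1\<close> by (simp add: powr_powr)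
      also have "\<dots> \<le> (1 / q) * (\<bar>g t\<bar> powr q) + (1 - 1 / q) * c"
        using False \<open>c > 0\<close> \<open>q \<ge> 1\<close> by (intro Youngs_inequality_0) auto
      also have "\<dots> \<le> h t / q + (1 - 1 / q) * c"
        using gh[OF that] \<open>q \<ge> 1\<close> by (simp add: divide_right_mono)
      finally show ?thesis .
    qed
    have lhs: "((\<lambda>t. c powr (1 - 1 / q) * (w t * g t)) has_integral c powr (1 - 1 / q) * J) S"
      by (rule has_integral_mult_right[OF wg])
    have rhs: "((\<lambda>t. (1 / q) * (w t * h t) + ((1 - 1 / q) * c) * w t) has_integral
        (1 / q) * H + ((1 - 1 / q) * c) * W) S"
      by (intro has_integral_add has_integral_mult_right wh w)
    have "norm (c powr (1 - 1 / q) * (w t * g t))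
        \<le> (1 / q) * (w t * h t) + ((1 - 1 / q) * c) * w t" if "t \<in> S" for t
      using mult_left_mono[OF Young[OF that] w_nonneg[OF that]] w_nonneg[OF that]
      by (simp add: abs_mult algebra_simps)
    then have "norm (integral S (\<lambda>t. c powr (1 - 1 / q) * (w t * g t)))
        \<le> integral S (\<lambda>t. (1 / q) * (w t * h t) + ((1 - 1 / q) * c) * w t)"
      using lhs rhs by (intro integral_norm_bound_integral) (auto simp: has_integral_integrable)
    then have "c powr (1 - 1 / q) * \<bar>J\<bar> \<le> (1 / q) * H + ((1 - 1 / q) * c) * W"
      by (simp only: integral_unique[OF lhs] integral_unique[OF rhs] real_norm_def abs_mult) simp
    also have "\<dots> \<le> (1 / q) * (c * W) + ((1 - 1 / q) * c) * W"
      using that \<open>q \<ge> 1\<close> unfolding cW by (simp add: divide_right_mono)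
    also have "\<dots> = c * W" by (simp add: algebra_simps)
    also have "\<dots> = c powr (1 - 1 / q) * (c powr (1 / q) * W)"
      using \<open>c > 0\<close> by (simp flip: powr_add)
    finally have "\<bar>J\<bar> \<le> c powr (1 / q) * W"
      using \<open>c > 0\<close> by simp
    also have "\<dots> = W powr (1 - 1 / q) * (H + d) powr (1 / q)"
      using \<open>W > 0\<close> \<open>H \<ge> 0\<close> that by (simp add: c_def powr_divide powr_diff)
    finally show ?thesis .
  qed
  have pos: "\<forall>\<^sub>F d in at_right 0. (0::real) < d"
    by (rule eventually_at_right_less)
  have "((\<lambda>d. W powr (1 - 1 / q) * (H + d) powr (1 / q)) \<longlongrightarrow>
      W powr (1 - 1 / q) * (H + 0) powr (1 / q)) (at_right 0)"
    using \<open>H \<ge> 0\<close> \<open>q \<ge> 1\<close>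
    by (intro tendsto_intros tendsto_powr2) (auto intro: eventually_mono[OF pos])
  moreover have "\<forall>\<^sub>F d in at_right 0. \<bar>J\<bar> \<le> W powr (1 - 1 / q) * (H + d) powr (1 / q)"
    using pos by eventually_elim (rule bound)
  ultimately have "\<bar>J\<bar> \<le> W powr (1 - 1 / q) * (H + 0) powr (1 / q)"
    by (rule tendsto_lowerbound) simp
  then show ?thesis by simp
qed

section \<open>Taylor's formula along a segment\<close>

text \<open>
  This is Taylor's formula at \<open>0\<close> for \<open>t \<mapsto> Df 0 (t * e + (1 - t) * c)\<close>. Passing to the parameter \<open>t\<close>
  treats end points to the left and to the right of \<open>c\<close> alike and puts the remainder in the form in
  which \<open>s\<close>-convexity applies.
\<close>

lemma Taylor_has_integral_along_segment:
  fixes Df :: "nat \<Rightarrow> real \<Rightarrow> real"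
  assumes deriv: "\<And>k x. k \<le> n \<Longrightarrow> x \<in> S \<Longrightarrow> (Df k has_vector_derivative Df (Suc k) x) (at x within S)"
    and "convex S" and "c \<in> S" and "e \<in> S"
  shows "((\<lambda>t. (1 - t) ^ n * Df (Suc n) (t * e + (1 - t) * c) * ((e - c) ^ Suc n / fact n))
    has_integral Df 0 e - (\<Sum>k\<le>n. (e - c) ^ k / fact k * Df k c)) {0..1}"
proof -
  define \<phi> where "\<phi> t = t * e + (1 - t) * c" for t
  define G where "G k t = (e - c) ^ k * Df k (\<phi> t)" for k t
  have \<phi>_in: "\<phi> ` {0..1} \<subseteq> S"
    using convexD[OF \<open>convex S\<close> \<open>e \<in> S\<close> \<open>c \<in> S\<close>] by (auto simp: \<phi>_def)
  have \<phi>_deriv: "(\<phi> has_vector_derivative (e - c)) (at t within {0..1})" for t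
    unfolding \<phi>_def has_real_derivative_iff_has_vector_derivative[symmetric]
    by (auto intro!: derivative_eq_intros)
  have "(G k has_vector_derivative G (Suc k) t) (at t within {0..1})"
    if "k < Suc n" "0 \<le> t" "t \<le> 1" for k t
  proof -
    have "(Df k has_vector_derivative Df (Suc k) (\<phi> t)) (at (\<phi> t) within \<phi> ` {0..1})"
      using that \<phi>_in by (intro has_vector_derivative_within_subset[OF deriv \<phi>_in]) auto
    from vector_diff_chain_within[OF \<phi>_deriv this]
    have "(Df k \<circ> \<phi> has_vector_derivative (e - c) * Df (Suc k) (\<phi> t)) (at t within {0..1})"
      by simp
    from has_vector_derivative_mult_right[OF this, of "(e - c) ^ k"]
    show ?thesis unfolding G_def o_def power_Suc by (simp only: mult_ac)
  qed
  from Taylor_has_integral[of "Suc n" G "G 0" 0 1, OF _ refl this]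
  show ?thesis
    by (simp add: G_def \<phi>_def lessThan_Suc_atMost mult_ac)
qed

section \<open>Remainder bound for \<open>s\<close>-convex powers of the derivative\<close>

lemma has_integral_one_minus_power:
  "((\<lambda>t. (1 - t) ^ n) has_integral 1 / real (n + 1)) {0..1::real}"
proof -
  define P :: "real \<Rightarrow> real" where "P t = - ((1 - t) ^ Suc n / real (Suc n))" for t
  have "(P has_real_derivative (1 - t) ^ n) (at t within {0..1})" for t
    unfolding P_def by (rule derivative_eq_intros refl | simp del: of_nat_Suc)+
  then have "((\<lambda>t. (1 - t) ^ n) has_integral (P 1 - P 0)) {0..1}"
    by (intro fundamental_theorem_of_calculus)
       (auto simp flip: has_real_derivative_iff_has_vector_derivative)
  then show ?thesis by (simp add: P_def)
qed

text \<open>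
  With \<open>A\<close> and \<open>B\<close> the values of an \<open>s\<close>-convex function at the ends of the segment, this integrates
  the bound that \<open>s\<close>-convexity provides, against the Taylor weight.
\<close>

lemma has_integral_Beta_s_convex_majorant:
  fixes s A B :: real
  assumes "s > 0"
  shows "((\<lambda>t. (1 - t) ^ n * (t powr s * A + (1 - t) powr s * B)) has_integral
    Beta (s + 1) (real n + 1) * A + Beta 1 (real n + s + 1) * B) {0..1}"
proof -
  have "((\<lambda>t. t powr s * (1 - t) powr real n * A + t powr 0 * (1 - t) powr (real n + s) * B)
    has_integral Beta (s + 1) (real n + 1) * A + Beta 1 (real n + s + 1) * B) {0..1}"
    using has_integral_Beta_real[of "s + 1" "real n + 1"]
      has_integral_Beta_real[of 1 "real n + s + 1"] assms
    by (intro has_integral_add has_integral_mult_left) simp_all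
  \<comment> \<open>At the end points \<open>0 powr 0 = 0\<close> differs from \<open>0 ^ 0 = 1\<close>, so the integrands are compared on the
    open interval only.\<close>
  then have "((\<lambda>t. t powr s * (1 - t) powr real n * A + t powr 0 * (1 - t) powr (real n + s) * B)
    has_integral Beta (s + 1) (real n + 1) * A + Beta 1 (real n + s + 1) * B) {0<..<1}"
    by (simp only: has_integral_Icc_iff_Ioo)
  then show ?thesis
    unfolding has_integral_Icc_iff_Ioo
    by (rule has_integral_eq[rotated])
       (auto simp: powr_add powr_realpow algebra_simps)
qed

text \<open>
  The one-sided estimate behind the theorem: the power mean inequality is applied to the remainder
  along the segment from \<open>c\<close> to \<open>e\<close>, with the \<open>s\<close>-convexity bound as \<open>h\<close>.
\<close>

lemma Taylor_remainder_s_convex_bound: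
  fixes Df :: "nat \<Rightarrow> real \<Rightarrow> real"
  assumes deriv: "\<And>k x. k \<le> n \<Longrightarrow> x \<in> S \<Longrightarrow> (Df k has_vector_derivative Df (Suc k) x) (at x within S)"
    and "convex S" and "c \<in> S" and "e \<in> S"
    and "q \<ge> 1" and "s > 0"
    and conv: "s_convex_on s S (\<lambda>x. \<bar>Df (Suc n) x\<bar> powr q)"
  shows "\<bar>Df 0 e - (\<Sum>k\<le>n. (e - c) ^ k / fact k * Df k c)\<bar>
    \<le> real (n + 1) powr (- (1 - 1 / q)) / fact n * (\<bar>e - c\<bar> ^ (n + 1)
      * (Beta (s + 1) (real n + 1) * \<bar>Df (Suc n) e\<bar> powr q
         + Beta 1 (real n + s + 1) * \<bar>Df (Suc n) c\<bar> powr q) powr (1 / q))"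
    (is "\<bar>?R\<bar> \<le> _ * (_ * ?H powr _)")
proof (cases "e = c")
  case True
  have "(\<Sum>k\<le>n. (e - c) ^ k / fact k * Df k c) = (\<Sum>k\<in>{0}. (e - c) ^ k / fact k * Df k c)"
    using True by (intro sum.mono_neutral_right) auto
  then show ?thesis using True by simp
next
  case False
  define K where "K = (e - c) ^ Suc n / fact n"
  have "K \<noteq> 0" using False by (simp add: K_def)
  have "((\<lambda>t. (1 - t) ^ n * Df (Suc n) (t * e + (1 - t) * c) * K) has_integral ?R) {0..1}"
    unfolding K_def by (rule Taylor_has_integral_along_segment) (use assms in auto)
  from has_integral_divide[OF this, of K]
  have J: "((\<lambda>t. (1 - t) ^ n * Df (Suc n) (t * e + (1 - t) * c)) has_integral ?R / K) {0..1}"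
    using \<open>K \<noteq> 0\<close> by simp
  have "\<bar>?R / K\<bar> \<le> (1 / real (n + 1)) powr (1 - 1 / q) * ?H powr (1 / q)"
  proof (rule powr_power_mean_le[OF has_integral_one_minus_power _ J
        has_integral_Beta_s_convex_majorant[OF \<open>s > 0\<close>]])
    fix t :: real assume "t \<in> {0..1}"
    then show "\<bar>Df (Suc n) (t * e + (1 - t) * c)\<bar> powr q
        \<le> t powr s * \<bar>Df (Suc n) e\<bar> powr q + (1 - t) powr s * \<bar>Df (Suc n) c\<bar> powr q"
      using conv \<open>c \<in> S\<close> \<open>e \<in> S\<close> unfolding s_convex_on_def by blast
  qed (use \<open>q \<ge> 1\<close> in auto)
  also have "(1 / real (n + 1)) powr (1 - 1 / q) = real (n + 1) powr (- (1 - 1 / q))"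
    by (simp only: powr_minus powr_divide powr_one_eq_one) (simp add: field_simps)
  finally have "\<bar>?R / K\<bar> * \<bar>K\<bar> \<le> real (n + 1) powr (- (1 - 1 / q)) * ?H powr (1 / q) * \<bar>K\<bar>"
    by (rule mult_right_mono) simp
  moreover have "\<bar>?R / K\<bar> * \<bar>K\<bar> = \<bar>?R\<bar>"
    using \<open>K \<noteq> 0\<close> by (simp add: abs_divide)
  moreover have "\<bar>K\<bar> = \<bar>e - c\<bar> ^ (n + 1) / fact n"
    by (simp add: K_def abs_mult power_abs)
  ultimately show ?thesis by (simp only: times_divide_eq_right times_divide_eq_left mult_ac)
qed

section \<open>The integral inequality\<close>

theorem theorem3:
  fixes n :: nat and I :: "real set" and f :: "real \<Rightarrow> real"
    and a b p q s lam :: real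
  assumes "n \<ge> 1"
    and "is_interval I" and "I \<subseteq> {0..}"
    and "a \<in> I" and "b \<in> I" and "a < b"
    and "n_times_differentiable_within n f (interior I \<union> {a..b}) I"
    and "higher_deriv_within I n f absolutely_integrable_on {a..b}"
    and "q \<ge> 1" and "1 / p = 1 - 1 / q"
    and "0 < s" and "s \<le> 1"
    and "s_convex_on s {a..b} (\<lambda>x. \<bar>higher_deriv_within I n f x\<bar> powr q)"
    and "lam \<in> {a..b}"
  shows "\<bar>(-1) ^ n * integral {a..b} f
          + (\<Sum>m=1..n. (-1) ^ (n - m + 2)
              * (((lam - a) ^ m - (lam - b) ^ m) / fact m)
              * higher_deriv_within I (m - 1) f lam)\<bar>
       \<le> real (n + 1) powr (- (1 / p)) / fact n
          * ((lam - a) ^ (n + 1)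
               * (Beta (s + 1) (real n + 1) * \<bar>higher_deriv_within I n f a\<bar> powr q
                  + Beta 1 (real n + s + 1) * \<bar>higher_deriv_within I n f lam\<bar> powr q) powr (1 / q)
             + (b - lam) ^ (n + 1)
               * (Beta (s + 1) (real n + 1) * \<bar>higher_deriv_within I n f b\<bar> powr q
                  + Beta 1 (real n + s + 1) * \<bar>higher_deriv_within I n f lam\<bar> powr q) powr (1 / q))"
proof -
  define D where "D k = higher_deriv_within I k f" for k
  \<comment> \<open>The derivatives of \<open>x \<mapsto> integral {a..x} f\<close>: the index is shifted by one against \<open>D\<close>.\<close>
  define F where "F = (\<lambda>k. case k of 0 \<Rightarrow> \<lambda>x. integral {a..x} f | Suc j \<Rightarrow> D j)"
  have F_simps: "F 0 = (\<lambda>x. integral {a..x} f)" "F (Suc k) = D k" for k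
    by (simp_all add: F_def)
  define R where "R e = F 0 e - (\<Sum>k\<le>n. (e - lam) ^ k / fact k * F k lam)" for e
  have "{a..b} \<subseteq> I"
    using mem_is_interval_1_I[OF \<open>is_interval I\<close> \<open>a \<in> I\<close> \<open>b \<in> I\<close>] by auto
  have D_deriv: "(D k has_vector_derivative D (Suc k) x) (at x within {a..b})"
    if "k < n" "x \<in> {a..b}" for k x
  proof -
    have "D k differentiable (at x within I)"
      using assms(7) that by (simp add: n_times_differentiable_within_def D_def)
    then have "(D k has_vector_derivative D (Suc k) x) (at x within I)"
      by (simp add: vector_derivative_works D_def)
    then show ?thesis
      using \<open>{a..b} \<subseteq> I\<close> by (rule has_vector_derivative_within_subset)
  qed
  have "continuous_on {a..b} f"
    unfolding continuous_on_eq_continuous_within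
  proof
    fix x assume "x \<in> {a..b}"
    from has_vector_derivative_continuous[OF D_deriv[OF _ this, of 0]]
    show "continuous (at x within {a..b}) f"
      using \<open>n \<ge> 1\<close> by (simp add: D_def)
  qed
  have F_deriv: "(F k has_vector_derivative F (Suc k) x) (at x within {a..b})"
    if "k \<le> n" "x \<in> {a..b}" for k x
  proof (cases k)
    case 0
    then show ?thesis
      using integral_has_vector_derivative[OF \<open>continuous_on {a..b} f\<close> that(2)]
      by (simp add: F_simps D_def)
  next
    case (Suc j)
    then show ?thesis
      using D_deriv[of j x] that by (simp add: F_simps)
  qed
  have bound: "\<bar>R e\<bar> \<le> real (n + 1) powr (- (1 / p)) / fact n * (\<bar>e - lam\<bar> ^ (n + 1)
      * (Beta (s + 1) (real n + 1) * \<bar>D n e\<bar> powr q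
         + Beta 1 (real n + s + 1) * \<bar>D n lam\<bar> powr q) powr (1 / q))" if "e \<in> {a..b}" for e
    using Taylor_remainder_s_convex_bound[of n "{a..b}" F lam e q s] F_deriv assms that
    by (simp add: R_def F_simps(2) D_def)
  have "F 0 b - F 0 a = integral {a..b} f"
    by (simp add: F_simps)
  moreover have "(\<Sum>k\<le>n. (b - lam) ^ k / fact k * F k lam) - (\<Sum>k\<le>n. (a - lam) ^ k / fact k * F k lam)
      = (\<Sum>m=1..n. ((b - lam) ^ m - (a - lam) ^ m) / fact m * D (m - 1) lam)"
  proof -
    have "(\<Sum>k\<le>n. (b - lam) ^ k / fact k * F k lam) - (\<Sum>k\<le>n. (a - lam) ^ k / fact k * F k lam)
        = (\<Sum>k\<le>n. ((b - lam) ^ k - (a - lam) ^ k) / fact k * F k lam)"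
      by (simp add: sum_subtractf algebra_simps diff_divide_distrib)
    also have "\<dots> = (\<Sum>m=1..n. ((b - lam) ^ m - (a - lam) ^ m) / fact m * F m lam)"
      by (intro sum.mono_neutral_right) (auto simp: not_le)
    also have "\<dots> = (\<Sum>m=1..n. ((b - lam) ^ m - (a - lam) ^ m) / fact m * D (m - 1) lam)"
      by (intro sum.cong refl) (auto simp: F_def split: nat.splits)
    finally show ?thesis .
  qed
  ultimately have RR: "R b - R a = integral {a..b} f
      - (\<Sum>m=1..n. ((b - lam) ^ m - (a - lam) ^ m) / fact m * D (m - 1) lam)"
    unfolding R_def by linarith
  have term_sign: "(-1) ^ (n - m + 2) * (((lam - a) ^ m - (lam - b) ^ m) / fact m) * D (m - 1) lam
      = - ((-1) ^ n * (((b - lam) ^ m - (a - lam) ^ m) / fact m * D (m - 1) lam))"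
    if "m \<in> {1..n}" for m
  proof -
    have "(lam - x) ^ m = (-1) ^ m * (x - lam) ^ m" for x
      using power_mult_distrib[of "-1" "x - lam" m] by simp
    moreover have "(-1) ^ (n - m + 2) * (-1) ^ m = ((-1) ^ n :: real)"
      using that by (simp flip: power_add)
    ultimately show ?thesis
      by (simp add: field_simps) (smt (verit) mult.assoc mult.commute)
  qed
  have "(-1) ^ n * integral {a..b} f
      + (\<Sum>m=1..n. (-1) ^ (n - m + 2) * (((lam - a) ^ m - (lam - b) ^ m) / fact m) * D (m - 1) lam)
      = (-1) ^ n * (R b - R a)"
    unfolding RR right_diff_distrib sum_distrib_left
    by (simp only: sum.cong[OF refl term_sign] sum_negf)
  then have "\<bar>(-1) ^ n * integral {a..b} f
      + (\<Sum>m=1..n. (-1) ^ (n - m + 2) * (((lam - a) ^ m - (lam - b) ^ m) / fact m) * D (m - 1) lam)\<bar>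
      = \<bar>R b - R a\<bar>"
    by (simp add: abs_mult power_abs)
  also have "\<dots> \<le> \<bar>R a\<bar> + \<bar>R b\<bar>" by linarith
  also note add_mono[OF bound[of a] bound[of b]]
  finally show ?thesis
    using \<open>lam \<in> {a..b}\<close> \<open>a < b\<close> by (simp add: D_def distrib_left abs_minus_commute[of a lam])
qed

end
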